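(* Let $G$ be a finite $3$-group with a normal subgroup $H\cong C_3\times C_3$. If $G/H$ is colourable, then $G$ is colourable.
   Context: A bijection $\sigma$ of a group $Q$ is a colouring bijection if the maps $x\mapsto\sigma(x)x$, $x\mapsto x^{-1}\sigma(x)$, $x\mapsto x^{-1}\sigma(x)x$ are all bijections of $Q$; $Q$ is colourable if it admits a colouring bijection. *)

theory Defs
  imports "HOL-Algebra.Algebra"
begin

text \<open>Only the values of \<open>\<sigma>\<close> on the carrier matter; nothing is required of \<open>\<sigma>\<close> outside it.\<close>

definition colouring_bijection :: "('a, 'm) monoid_scheme \<Rightarrow> ('a \<Rightarrow> 'a) \<Rightarrow> bool" where
  "colouring_bijection Q \<sigma> \<longleftrightarrow>
     bij_betw \<sigma> (carrier Q) (carrier Q) \<and>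
     bij_betw (\<lambda>x. \<sigma> x \<otimes>\<^bsub>Q\<^esub> x) (carrier Q) (carrier Q) \<and>
     bij_betw (\<lambda>x. inv\<^bsub>Q\<^esub> x \<otimes>\<^bsub>Q\<^esub> \<sigma> x) (carrier Q) (carrier Q) \<and>
     bij_betw (\<lambda>x. inv\<^bsub>Q\<^esub> x \<otimes>\<^bsub>Q\<^esub> \<sigma> x \<otimes>\<^bsub>Q\<^esub> x) (carrier Q) (carrier Q)"

definition colourable :: "('a, 'm) monoid_scheme \<Rightarrow> bool" where
  "colourable Q \<longleftrightarrow> (\<exists>\<sigma>. colouring_bijection Q \<sigma>)"

end

theory Submission
  imports Defs
begin

text \<open>Since \<open>G\<close> is a 3-group, it acts on \<open>H\<close>, viewed as a plane over the field with three elements,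
  by unipotent matrices. Choose representatives \<open>t\<close> of the cosets of \<open>H\<close> and lift a colouring
  bijection \<open>\<tau>\<close> of the quotient by \<open>\<sigma> (t h) = s (A h)\<close>, where \<open>s\<close> represents \<open>\<tau> (t H)\<close> and
  \<open>A\<close> is a linear map of \<open>H\<close> depending on the coset. Each of the four maps then permutes the cosets
  and is affine on every coset, so it suffices to choose \<open>A\<close> such that four \<open>2 \<times> 2\<close>
  determinants do not vanish. The companion matrices \<open>A = (0, -D; 1, T)\<close> are enough for that.\<close>

section \<open>Linear algebra over the field with three elements\<close>

text \<open>Cramer's rule: combining the two congruences with the adjugate matrix shows that 3
  divides the determinant times \<open>i\<close> and times \<open>j\<close>, and 3 is prime.\<close>

lemma cong3_kernel_trivial:
  fixes \<alpha> \<beta> \<gamma> \<delta> i j :: int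
  assumes "\<not> 3 dvd \<alpha> * \<delta> - \<beta> * \<gamma>"
    and 1: "3 dvd \<alpha> * i + \<beta> * j" and 2: "3 dvd \<gamma> * i + \<delta> * j"
  shows "3 dvd i \<and> 3 dvd j"
proof -
  have p: "Factorial_Ring.prime (3::int)" by simp
  have "3 dvd \<delta> * (\<alpha> * i + \<beta> * j) - \<beta> * (\<gamma> * i + \<delta> * j)"
    using 1 2 by (intro dvd_diff dvd_mult)
  then have "3 dvd (\<alpha> * \<delta> - \<beta> * \<gamma>) * i" by (simp add: algebra_simps)
  moreover have "3 dvd \<alpha> * (\<gamma> * i + \<delta> * j) - \<gamma> * (\<alpha> * i + \<beta> * j)"
    using 1 2 by (intro dvd_diff dvd_mult)
  then have "3 dvd (\<alpha> * \<delta> - \<beta> * \<gamma>) * j" by (simp add: algebra_simps)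
  ultimately show ?thesis
    using assms(1) p by (simp add: prime_dvd_mult_iff)
qed

text \<open>Over the field with three elements there is a nonzero \<open>D \<noteq> -b\<close>, and then \<open>T\<close> has only two values to avoid.\<close>

lemma exists_det_trace_mod_3:
  fixes a b :: int
  shows "\<exists>D T. \<not> 3 dvd D \<and> \<not> 3 dvd D + b \<and> \<not> 3 dvd 1 + T + a + D \<and> \<not> 3 dvd 1 - T + b - a + D"
proof -
  obtain D :: int where D: "\<not> 3 dvd D" "\<not> 3 dvd D + b"
  proof (cases "3 dvd 1 + b")
    case True
    then have "\<not> 3 dvd 2 + b" by presburger
    then show ?thesis using that[of 2] by simp
  next
    case False
    then show ?thesis using that[of 1] by simp
  qed
  have "(\<not> 3 dvd x + 0 \<and> \<not> 3 dvd y - 0) \<or> (\<not> 3 dvd x + 1 \<and> \<not> 3 dvd y - 1) \<or>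
    (\<not> 3 dvd x + 2 \<and> \<not> 3 dvd y - 2)" for x y :: int
    by presburger
  from this[of "1 + a + D" "1 + b - a + D"]
  obtain T where "\<not> 3 dvd (1 + a + D) + T" "\<not> 3 dvd (1 + b - a + D) - T" by blast
  then have "\<not> 3 dvd 1 + T + a + D" "\<not> 3 dvd 1 - T + b - a + D"
    by (simp_all add: algebra_simps)
  with D show ?thesis by blast
qed

section \<open>Lifting a colouring through a plane with unipotent action\<close>

text \<open>\<open>E\<close> gives coordinates modulo 3 on \<open>H\<close>, in which conjugation by \<open>x\<close> acts by the unipotent
  matrix \<open>(1, c x; 0, 1)\<close>.\<close>

locale unipotent_plane = normal H G for H and G (structure) +
  fixes E :: "int \<Rightarrow> int \<Rightarrow> 'a" and c :: "'a \<Rightarrow> int"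
  assumes E_in: "E i j \<in> H"
    and E_surj: "h \<in> H \<Longrightarrow> \<exists>i j. h = E i j"
    and E_mult: "E i j \<otimes> E k l = E (i + k) (j + l)"
    and E_eq_iff: "E i j = E k l \<longleftrightarrow> 3 dvd i - k \<and> 3 dvd j - l"
    and E_swap: "x \<in> carrier G \<Longrightarrow> E i j \<otimes> x = x \<otimes> E (i + c x * j) j"
begin

lemma E_closed [simp]: "E i j \<in> carrier G"
  using E_in subset by blast

lemma E_zero: "E 0 0 = \<one>"
  using E_mult[of 0 0 0 0] by (metis E_closed add_0 r_cancel_one)

lemma E_inv: "inv (E i j) = E (-i) (-j)"
  by (rule inv_equality) (simp_all add: E_mult E_zero)

text \<open>Moving \<open>E 0 1\<close> past \<open>x \<otimes> y\<close> at once or in two steps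
  gives the same element. Since \<open>E\<close> sees its arguments only modulo 3, \<open>c\<close>
  is additive only up to multiples of 3.\<close>

lemma c_mult: 
  assumes "x \<in> carrier G" "y \<in> carrier G"
  shows "3 dvd c (x \<otimes> y) - (c x + c y)"
proof -
  have "x \<otimes> y \<otimes> E (c (x \<otimes> y)) 1 = E 0 1 \<otimes> (x \<otimes> y)"
    using assms by (simp add: E_swap[of "x \<otimes> y"])
  also have "\<dots> = (E 0 1 \<otimes> x) \<otimes> y"
    using assms by (simp add: m_assoc)
  also have "\<dots> = x \<otimes> (E (c x) 1 \<otimes> y)"
    using assms by (simp add: E_swap[of x] m_assoc)
  also have "\<dots> = x \<otimes> y \<otimes> E (c x + c y) 1"
    using assms by (simp add: E_swap[of y] m_assoc)
  finally have "E (c (x \<otimes> y)) 1 = E (c x + c y) 1"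
    using assms by (simp add: m_assoc)
  then show ?thesis by (simp add: E_eq_iff)
qed

lemma c_inv_mult:
  assumes "x \<in> carrier G" "y \<in> carrier G"
  shows "3 dvd c (inv x \<otimes> y) - (c y - c x)"
proof -
  have "3 dvd c y - (c x + c (inv x \<otimes> y))"
    using c_mult[of x "inv x \<otimes> y"] assms by (simp add: m_assoc[symmetric])
  then show ?thesis
    using dvd_minus_iff[of 3 "c y - (c x + c (inv x \<otimes> y))"] by (simp add: algebra_simps)
qed

text \<open>This moves \<open>H\<close>-factors past the products of an inverted and a plain
  representative that occur in the third and fourth colouring maps.\<close>

lemma E_swap_inv_mult:
  assumes "x \<in> carrier G" "y \<in> carrier G"
  shows "E i j \<otimes> (inv x \<otimes> y) = inv x \<otimes> y \<otimes> E (i + (c y - c x) * j) j"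
proof -
  have "3 dvd (c (inv x \<otimes> y) - (c y - c x)) * j"
    using c_inv_mult[OF assms] by simp
  then show ?thesis
    using assms by (simp add: E_swap[of "inv x \<otimes> y"] E_eq_iff algebra_simps)
qed

text \<open>The quotient consists of right cosets, while the coordinates multiply a representative
  on the right; normality reconciles the two.\<close>

lemma coset_coordinates:
  assumes "x \<in> carrier G" "y \<in> carrier G" "H #> x = H #> y"
  shows "\<exists>i j. y = x \<otimes> E i j"
proof -
  have "y \<otimes> inv x \<in> H"
    using assms rcos_module[of x y] repr_independenceD[OF is_subgroup, of y x] by (simp add: is_group)
  then have "inv x \<otimes> (y \<otimes> inv x) \<otimes> x \<in> H"
    using assms by (intro inv_op_closed1)
  then have "inv x \<otimes> y \<in> H" using assms by (simp add: m_assoc)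
  then obtain i j where "inv x \<otimes> y = E i j" using E_surj by blast
  then have "y = x \<otimes> E i j" using assms by (metis E_closed inv_solve_left)
  then show ?thesis by blast
qed

lemma coset_mult_E:
  assumes "x \<in> carrier G" 
  shows "H #> (x \<otimes> E i j) = H #> x"
proof -
  have "(x \<otimes> E i j) \<otimes> inv x \<in> H"
    using assms inv_op_closed2[of x "E i j"] E_in by simp
  then have "x \<otimes> E i j \<in> H #> x"
    using assms rcos_module[of x "x \<otimes> E i j"] by (simp add: is_group)
  then show ?thesis
    using assms repr_independence[OF _ _ is_subgroup] by metis
qed

text \<open>The criterion used for all four maps. Injectivity of \<open>m\<close> modulo
  \<open>H\<close> separates distinct cosets, the determinant separates points within one coset, and
  finiteness turns injectivity into bijectivity.\<close>

lemma bij_betw_coset_matrix: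
  assumes fin: "finite (carrier G)"
    and rep: "\<And>x. x \<in> carrier G \<Longrightarrow> t (H #> x) \<in> carrier G \<and> x = t (H #> x) \<otimes> E (I x) (J x)"
    and m: "\<And>q. q \<in> carrier (G Mod H) \<Longrightarrow> m q \<in> carrier G"
    and inj: "inj_on (\<lambda>q. H #> m q) (carrier (G Mod H))"
    and f: "\<And>x q. x \<in> carrier G \<Longrightarrow> q = H #> x \<Longrightarrow>
      f x = m q \<otimes> E (\<alpha> q * I x + \<beta> q * J x) (\<gamma> q * I x + \<delta> q * J x)"
    and det: "\<And>q. q \<in> carrier (G Mod H) \<Longrightarrow> \<not> 3 dvd \<alpha> q * \<delta> q - \<beta> q * \<gamma> q"
  shows "bij_betw f (carrier G) (carrier G)"
proof -
  have coset: "H #> x \<in> carrier (G Mod H)" if "x \<in> carrier G" for x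
    using that by (auto simp: FactGroup_def RCOSETS_def)
  have "inj_on f (carrier G)"
  proof (rule inj_onI)
    fix x y assume xy: "x \<in> carrier G" "y \<in> carrier G" "f x = f y"
    \<comment> \<open>The \<open>E\<close>-factor does not change the coset, so the coset of
      \<open>f z\<close> depends only on that of \<open>z\<close>.\<close>
    have "H #> f z = H #> m (H #> z)" if "z \<in> carrier G" for z
      using that f[OF that refl] m[OF coset[OF that]] by (simp only: coset_mult_E)
    then have "H #> m (H #> x) = H #> m (H #> y)" using xy by metis
    then have q: "H #> x = H #> y" using inj coset xy by (simp add: inj_on_def)
    define q where "q = H #> x"
    have qc: "q \<in> carrier (G Mod H)" using coset xy q_def by simp
    have "E (\<alpha> q * I x + \<beta> q * J x) (\<gamma> q * I x + \<delta> q * J x) =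
      E (\<alpha> q * I y + \<beta> q * J y) (\<gamma> q * I y + \<delta> q * J y)"
      using xy f[of x q] f[of y q] q q_def m[OF qc] by simp
    \<comment> \<open>The difference of the two coordinate vectors lies in the kernel of the matrix
      modulo 3.\<close>
    then have "3 dvd \<alpha> q * (I x - I y) + \<beta> q * (J x - J y)"
      "3 dvd \<gamma> q * (I x - I y) + \<delta> q * (J x - J y)"
      by (simp_all add: E_eq_iff algebra_simps)
    then have "3 dvd I x - I y \<and> 3 dvd J x - J y"
      by (rule cong3_kernel_trivial[OF det[OF qc]])
    then have "E (I x) (J x) = E (I y) (J y)" by (simp add: E_eq_iff)
    then show "x = y" using rep[OF xy(1)] rep[OF xy(2)] q by simp
  qed
  moreover have "f ` carrier G \<subseteq> carrier G"
    using f m coset by auto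
  ultimately show ?thesis
    using endo_inj_surj[OF fin] by (simp add: bij_betw_def)
qed

text \<open>Write \<open>U k\<close> for the matrix \<open>(1, k; 0, 1)\<close>. Collecting the
  \<open>H\<close>-factors on the right, with \<open>a\<close> and \<open>b\<close> the values of
  \<open>c\<close> at \<open>t q\<close> and \<open>s q\<close>, gives the matrices
  \<open>A\<close>, \<open>U a * A + 1\<close>, \<open>A - U (b - a)\<close> and
  \<open>U a * A - U b + 1\<close> for the four maps.\<close>

lemma colourable_if_quotient_colourable:
  assumes fin: "finite (carrier G)" and col: "colourable (G Mod H)"
  shows "colourable G"
proof -
  interpret Q: group "G Mod H" by (rule factorgroup_is_group)
  interpret \<pi>: group_hom G "G Mod H" "\<lambda>x. H #> x"
    by unfold_locales (rule r_coset_hom_Mod)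
  obtain \<tau> where \<tau>: "colouring_bijection (G Mod H) \<tau>"
    using col by (auto simp: colourable_def)
  define t where "t q = (SOME x. x \<in> carrier G \<and> H #> x = q)" for q
  have t: "t q \<in> carrier G \<and> H #> t q = q" if "q \<in> carrier (G Mod H)" for q
    unfolding t_def by (rule someI_ex) (use that in \<open>auto simp: FactGroup_def RCOSETS_def\<close>)
  then have tc: "t q \<in> carrier G" and tq: "H #> t q = q" if "q \<in> carrier (G Mod H)" for q
    using that by blast+
  define s where "s q = t (\<tau> q)" for q
  have \<tau>c: "\<tau> q \<in> carrier (G Mod H)" if "q \<in> carrier (G Mod H)" for q
    using \<tau> that by (auto simp: colouring_bijection_def dest: bij_betwE)
  have sc: "s q \<in> carrier G" and sq: "H #> s q = \<tau> q" if "q \<in> carrier (G Mod H)" for q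
    using tc tq \<tau>c that by (auto simp: s_def)
  have "\<exists>i j. x = t (H #> x) \<otimes> E i j" if "x \<in> carrier G" for x
    using coset_coordinates[of "t (H #> x)" x] t[of "H #> x"] that by auto
  then obtain I J where IJ: "\<And>x. x \<in> carrier G \<Longrightarrow> x = t (H #> x) \<otimes> E (I x) (J x)"
    by metis
  have rep: "t (H #> x) \<in> carrier G \<and> x = t (H #> x) \<otimes> E (I x) (J x)"
    if "x \<in> carrier G" for x
    using IJ t that by simp
  define a where "a q = c (t q)" for q
  define b where "b q = c (s q)" for q
  \<comment> \<open>These are the four determinants; \<open>D\<close> and \<open>T\<close> are
    chosen separately for each coset.\<close>
  have "\<forall>q. \<exists>D T. \<not> 3 dvd D \<and> \<not> 3 dvd D + b q \<and> \<not> 3 dvd 1 + T + a q + D \<and>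
      \<not> 3 dvd 1 - T + b q - a q + D"
    using exists_det_trace_mod_3 by blast
  then obtain D T where D1: "\<And>q. \<not> 3 dvd D q" and D2: "\<And>q. \<not> 3 dvd D q + b q"
    and D3: "\<And>q. \<not> 3 dvd 1 + T q + a q + D q" and D4: "\<And>q. \<not> 3 dvd 1 - T q + b q - a q + D q"
    by metis
  \<comment> \<open>The companion matrix \<open>A\<close> acts on the column vector
    \<open>(I x, J x)\<close>.\<close>
  define \<sigma> where "\<sigma> x = s (H #> x) \<otimes> E (- D (H #> x) * J x) (I x + T (H #> x) * J x)" for x
  have "bij_betw \<sigma> (carrier G) (carrier G)"
  proof (rule bij_betw_coset_matrix[where t = t and I = I and J = J and m = s
      and \<alpha> = "\<lambda>q. 0" and \<beta> = "\<lambda>q. - D q" and \<gamma> = "\<lambda>q. 1" and \<delta> = T])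
    show "inj_on (\<lambda>q. H #> s q) (carrier (G Mod H))"
      using \<tau> by (simp add: colouring_bijection_def bij_betw_def sq cong: inj_on_cong)
  qed (use fin rep sc D1 in \<open>auto simp: \<sigma>_def\<close>)
  moreover have "bij_betw (\<lambda>x. \<sigma> x \<otimes> x) (carrier G) (carrier G)"
  proof (rule bij_betw_coset_matrix[where t = t and I = I and J = J and m = "\<lambda>q. s q \<otimes> t q"
      and \<alpha> = "\<lambda>q. 1 + a q" and \<beta> = "\<lambda>q. a q * T q - D q" and \<gamma> = "\<lambda>q. 1" and \<delta> = "\<lambda>q. 1 + T q"])
    \<comment> \<open>The projection onto \<open>G Mod H\<close> is a homomorphism, so this is the
      condition on \<open>\<tau>\<close> for the product of \<open>\<tau> q\<close> and
      \<open>q\<close>.\<close>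
    show "inj_on (\<lambda>q. H #> (s q \<otimes> t q)) (carrier (G Mod H))"
      using \<tau> by (simp add: colouring_bijection_def bij_betw_def sq tq sc tc cong: inj_on_cong)
    show "\<not> 3 dvd (1 + a q) * (1 + T q) - (a q * T q - D q) * 1" for q
      using D3[of q] by (simp add: algebra_simps)
    fix x q assume x: "x \<in> carrier G" and q: "q = H #> x"
    then have qc: "q \<in> carrier (G Mod H)" by simp
    note [simp] = tc[OF qc] sc[OF qc]
    have "\<sigma> x \<otimes> x = s q \<otimes> E (- D q * J x) (I x + T q * J x) \<otimes> (t q \<otimes> E (I x) (J x))"
      unfolding \<sigma>_def q[symmetric] using IJ[OF x, folded q] by simp
    also have "\<dots> = s q \<otimes> (E (- D q * J x) (I x + T q * J x) \<otimes> t q) \<otimes> E (I x) (J x)"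
      by (simp add: m_assoc)
    \<comment> \<open>Passing \<open>t q\<close> applies \<open>U a\<close> to the vector of the
      first \<open>E\<close>-factor.\<close>
    also have "\<dots> = s q \<otimes> t q \<otimes> (E (- D q * J x + a q * (I x + T q * J x)) (I x + T q * J x) \<otimes> E (I x) (J x))"
      by (simp add: m_assoc E_swap[of "t q"] a_def)
    finally show "\<sigma> x \<otimes> x = s q \<otimes> t q \<otimes> E ((1 + a q) * I x + (a q * T q - D q) * J x)
        (1 * I x + (1 + T q) * J x)"
      by (simp add: E_mult algebra_simps)
  qed (use fin rep sc tc in auto)
  moreover have "bij_betw (\<lambda>x. inv x \<otimes> \<sigma> x) (carrier G) (carrier G)"
  proof (rule bij_betw_coset_matrix[where t = t and I = I and J = J and m = "\<lambda>q. inv (t q) \<otimes> s q"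
      and \<alpha> = "\<lambda>q. - 1" and \<beta> = "\<lambda>q. a q - b q - D q" and \<gamma> = "\<lambda>q. 1" and \<delta> = "\<lambda>q. T q - 1"])
    show "inj_on (\<lambda>q. H #> (inv (t q) \<otimes> s q)) (carrier (G Mod H))"
      using \<tau> by (simp add: colouring_bijection_def bij_betw_def sq tq sc tc cong: inj_on_cong)
    show "\<not> 3 dvd - 1 * (T q - 1) - (a q - b q - D q) * 1" for q
      using D4[of q] by (simp add: algebra_simps)
    fix x q assume x: "x \<in> carrier G" and q: "q = H #> x"
    then have qc: "q \<in> carrier (G Mod H)" by simp
    note [simp] = tc[OF qc] sc[OF qc]
    have "inv x \<otimes> \<sigma> x = inv (t q \<otimes> E (I x) (J x)) \<otimes> (s q \<otimes> E (- D q * J x) (I x + T q * J x))"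
      unfolding \<sigma>_def q[symmetric] using IJ[OF x, folded q] by simp
    also have "\<dots> = E (- I x) (- J x) \<otimes> (inv (t q) \<otimes> s q) \<otimes> E (- D q * J x) (I x + T q * J x)"
      by (simp add: m_assoc inv_mult_group E_inv)
    \<comment> \<open>The inverse of \<open>x\<close> contributes the negated vector on the left;
      passing the representatives applies \<open>U (b - a)\<close> to it.\<close>
    also have "\<dots> = inv (t q) \<otimes> s q \<otimes> (E (- I x + (b q - a q) * - J x) (- J x) \<otimes> E (- D q * J x) (I x + T q * J x))"
      by (simp only: E_swap_inv_mult[OF tc[OF qc] sc[OF qc]] a_def b_def) (simp add: m_assoc)
    finally show "inv x \<otimes> \<sigma> x = inv (t q) \<otimes> s q \<otimes> E (- 1 * I x + (a q - b q - D q) * J x)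
        (1 * I x + (T q - 1) * J x)"
      by (simp add: E_mult algebra_simps)
  qed (use fin rep sc tc in auto)
  moreover have "bij_betw (\<lambda>x. inv x \<otimes> \<sigma> x \<otimes> x) (carrier G) (carrier G)"
  proof (rule bij_betw_coset_matrix[where t = t and I = I and J = J and m = "\<lambda>q. inv (t q) \<otimes> s q \<otimes> t q"
      and \<alpha> = a and \<beta> = "\<lambda>q. a q * T q - b q - D q" and \<gamma> = "\<lambda>q. 1" and \<delta> = T])
    show "inj_on (\<lambda>q. H #> (inv (t q) \<otimes> s q \<otimes> t q)) (carrier (G Mod H))"
      using \<tau> by (simp add: colouring_bijection_def bij_betw_def sq tq sc tc cong: inj_on_cong)
    show "\<not> 3 dvd a q * T q - (a q * T q - b q - D q) * 1" for q
      using D2[of q] by (simp add: algebra_simps)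
    fix x q assume x: "x \<in> carrier G" and q: "q = H #> x"
    then have qc: "q \<in> carrier (G Mod H)" by simp
    note [simp] = tc[OF qc] sc[OF qc]
    let ?u = "inv (t q) \<otimes> s q"
    have "inv x \<otimes> \<sigma> x \<otimes> x = inv (t q \<otimes> E (I x) (J x)) \<otimes> (s q \<otimes> E (- D q * J x) (I x + T q * J x)) \<otimes> (t q \<otimes> E (I x) (J x))"
      unfolding \<sigma>_def q[symmetric] using IJ[OF x, folded q] by simp
    also have "\<dots> = E (- I x) (- J x) \<otimes> ?u \<otimes> E (- D q * J x) (I x + T q * J x) \<otimes> t q \<otimes> E (I x) (J x)"
      by (simp add: m_assoc inv_mult_group E_inv)
    also have "\<dots> = ?u \<otimes> (E (- I x + (b q - a q) * - J x) (- J x) \<otimes> E (- D q * J x) (I x + T q * J x)) \<otimes> t q \<otimes> E (I x) (J x)"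
      by (simp only: E_swap_inv_mult[OF tc[OF qc] sc[OF qc]] a_def b_def) (simp add: m_assoc)
    also have "\<dots> = ?u \<otimes> (E (- I x + (b q - a q) * - J x - D q * J x) (I x + T q * J x - J x) \<otimes> t q) \<otimes> E (I x) (J x)"
      by (simp add: E_mult m_assoc)
    \<comment> \<open>Passing \<open>t q\<close> applies \<open>U a\<close> to the combined vector,
      where modulo 3 the product of \<open>U a\<close> and \<open>U (b - a)\<close> is
      \<open>U b\<close>.\<close>
    also have "\<dots> = ?u \<otimes> t q \<otimes> (E (- I x + (b q - a q) * - J x - D q * J x + a q * (I x + T q * J x - J x)) (I x + T q * J x - J x) \<otimes> E (I x) (J x))"
      by (simp only: E_swap[OF tc[OF qc]] a_def) (simp add: m_assoc)
    finally show "inv x \<otimes> \<sigma> x \<otimes> x = ?u \<otimes> t q \<otimes> E (a q * I x + (a q * T q - b q - D q) * J x)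
        (1 * I x + T q * J x)"
      by (simp add: E_mult algebra_simps)
  qed (use fin rep sc tc in auto)
  ultimately show ?thesis
    by (auto simp: colourable_def colouring_bijection_def)
qed

end

section \<open>Central elements in normal subgroups of p-groups\<close>

text \<open>The class equation restricted to \<open>H\<close>: the conjugation orbits of noncentral
  elements have size divisible by \<open>p\<close>, so \<open>p\<close> divides the number of
  central elements of \<open>H\<close>, one of which is the identity.\<close>

lemma (in group) p_group_normal_meets_centre:
  assumes p: "Factorial_Ring.prime p" and ord: "order G = p ^ n"
    and H: "H \<lhd> G" and dvd: "p dvd card H"
  shows "\<exists>z\<in>H. z \<noteq> \<one> \<and> (\<forall>g\<in>carrier G. g \<otimes> z = z \<otimes> g)"
proof -
  interpret H: normal H G by fact
  define \<phi> where "\<phi> = (\<lambda>g. \<lambda>h\<in>carrier G. g \<otimes> h \<otimes> inv g)"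
  interpret A: group_action G "carrier G" \<phi>
    unfolding \<phi>_def by (rule action_by_conjugation)
  have fin: "finite (carrier G)"
    using ord p by (metis order_gt_0_iff_finite prime_gt_0_nat zero_less_power)
  have finH: "finite H" using fin H.subset finite_subset by blast
  define Z where "Z = {z\<in>H. \<forall>g\<in>carrier G. g \<otimes> z = z \<otimes> g}"
  define C where "C = orbit G \<phi> ` (H - Z)"
  have Hc: "x \<in> carrier G" if "x \<in> H" for x using that H.subset by blast
  have conj: "\<phi> g x = x \<longleftrightarrow> g \<otimes> x = x \<otimes> g" if "g \<in> carrier G" "x \<in> carrier G" for g x
    using that inv_solve_right[of x "g \<otimes> x" g] unfolding \<phi>_def by auto
  \<comment> \<open>Normality keeps the orbit inside \<open>H\<close>, and a central element is
    alone in its orbit.\<close>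
  have sub: "orbit G \<phi> x \<subseteq> H - Z" if x: "x \<in> H - Z" for x
  proof
    fix y assume y: "y \<in> orbit G \<phi> x"
    then obtain g where g: "g \<in> carrier G" "y = g \<otimes> x \<otimes> inv g"
      using x Hc by (auto simp: orbit_def \<phi>_def)
    have yH: "y \<in> H" using g x H.inv_op_closed2 by simp
    have "x \<in> Z" if "y \<in> Z"
    proof -
      have "x \<in> orbit G \<phi> y" using A.orbit_sym[of x y] y yH x Hc by simp
      then have "x = y" using that yH Hc conj by (auto simp: orbit_def Z_def)
      then show ?thesis using that by simp
    qed
    then show "y \<in> H - Z" using x yH by blast
  qed
  have "\<Union>C = H - Z"
    using sub A.orbit_refl Hc unfolding C_def by blast
  moreover have "disjoint C"
  proof -
    have "C \<subseteq> orbits G (carrier G) \<phi>" using Hc by (auto simp: C_def orbits_def)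
    moreover have "disjoint (orbits G (carrier G) \<phi>)"
      using A.disjoint_union by (auto simp: pairwise_def disjnt_def)
    ultimately show ?thesis using pairwise_subset by blast
  qed
  moreover have "p dvd card c" if c: "c \<in> C" for c
  proof -
    obtain x where x: "x \<in> H" "x \<notin> Z" "c = orbit G \<phi> x"
      using c by (auto simp: C_def)
    \<comment> \<open>By orbit-stabilizer the size of an orbit is a power of \<open>p\<close>; size
      1 would make its element central.\<close>
    have "card c dvd p ^ n"
      unfolding x(3) ord[symmetric] A.orbit_stabilizer_theorem[OF Hc[OF x(1)], symmetric]
      by (rule dvd_triv_left)
    moreover have "card c \<noteq> 1"
    proof
      assume "card c = 1"
      then have "c = {x}" using A.orbit_refl[of x] x Hc by (auto simp: card_1_singleton_iff)
      then have "\<forall>g\<in>carrier G. \<phi> g x = x" using x by (auto simp: orbit_def)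
      then show False using x conj Hc by (auto simp: Z_def)
    qed
    ultimately obtain k where "card c = p ^ k" "k \<noteq> 0"
      using divides_primepow_nat[OF p] by (metis power_0)
    then show ?thesis by simp
  qed
  ultimately have "p dvd card (H - Z)"
    using dvd_partition[of C p] finH by (simp add: pairwise_def disjnt_def)
  moreover have "card H = card Z + card (H - Z)"
    using finH card_Diff_subset[of Z H] card_mono[of H Z] by (simp add: Z_def)
  ultimately have "p dvd card Z" using dvd by (simp add: dvd_add_left_iff)
  moreover have "\<one> \<in> Z" by (simp add: Z_def)
  ultimately have "Z \<noteq> {\<one>}" using p by auto
  then show ?thesis using \<open>\<one> \<in> Z\<close> by (auto simp: Z_def)
qed

section \<open>Construction of the unipotent coordinates\<close>

text \<open>A unit modulo 3 squares to 1, so its odd powers equal itself. It is applied with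
  \<open>m\<close> the order of a 3-group, which is odd.\<close>

lemma odd_power_cong_mod_3:
  fixes j :: int
  assumes "3 dvd j ^ m - 1" "odd m"
  shows "3 dvd j - 1"
proof -
  obtain k where m: "m = Suc (2 * k)" using assms(2) by (metis oddE Suc_eq_plus1)
  have nz: "\<not> 3 dvd j"
  proof
    assume "3 dvd j"
    then have "3 dvd j ^ m" using m by simp
    then show False using assms(1) by presburger
  qed
  then have "j mod 3 = 1 \<or> j mod 3 = 2" by presburger
  then have "(j * j) mod 3 = 1" by (auto simp: mod_mult_eq[symmetric, of j])
  then have "(j * j) ^ k mod 3 = 1" using power_mod[of "j * j" 3 k] by simp
  then have "3 dvd (j * j) ^ k - 1" by presburger
  then have "3 dvd j * ((j * j) ^ k - 1)" by simp
  then have "3 dvd j ^ m - j"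
    by (simp add: m power_mult power2_eq_square algebra_simps)
  then show ?thesis using assms(1) by presburger
qed

text \<open>The isomorphism enters the construction of coordinates only through these three
  facts.\<close>

lemma C3_times_C3_properties:
  fixes G (structure)
  assumes G: "group G" and iso: "G \<cong> integer_mod_group 3 \<times>\<times> integer_mod_group 3"
  shows "card (carrier G) = 9" and "comm_group G"
    and "x \<in> carrier G \<Longrightarrow> x \<otimes> x \<otimes> x = \<one>"
proof -
  interpret group G by fact
  let ?K = "integer_mod_group 3 \<times>\<times> integer_mod_group 3"
  have carrier: "carrier ?K = {0..<3} \<times> {0..<3}" by (simp add: carrier_integer_mod_group)
  obtain f where "f \<in> iso G ?K" using iso by (auto simp: is_iso_def)
  then have bij: "bij_betw f (carrier G) (carrier ?K)" and hom: "f \<in> hom G ?K"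
    by (auto simp: iso_def)
  have mult: "f (x \<otimes> y) = f x \<otimes>\<^bsub>?K\<^esub> f y" if "x \<in> carrier G" "y \<in> carrier G" for x y
    using hom_mult[OF hom that] .
  have inj: "x = y" if "f x = f y" "x \<in> carrier G" "y \<in> carrier G" for x y
    using bij that by (auto simp: bij_betw_def inj_on_def)
  show "card (carrier G) = 9"
    using bij_betw_same_card[OF bij] unfolding carrier by simp
  show "comm_group G"
  proof (rule group_comm_groupI)
    fix x y assume xy: "x \<in> carrier G" "y \<in> carrier G"
    have "f (x \<otimes> y) = f (y \<otimes> x)"
      using xy by (cases "f x"; cases "f y") (simp add: mult add.commute)
    then show "x \<otimes> y = y \<otimes> x" using inj xy by blast
  qed
  assume x: "x \<in> carrier G"
  obtain i j where ij: "f x = (i, j)" by fastforce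
  have "f \<one> = (0, 0)"
    using hom_one[OF hom] by (simp add: DirProd_group)
  moreover have "f (x \<otimes> x \<otimes> x) = (0, 0)"
    using x by (simp add: mult ij mod_simps)
  ultimately show "x \<otimes> x \<otimes> x = \<one>" using inj x by simp
qed

lemma (in group) int_pow_commute:
  assumes "x \<otimes> y = y \<otimes> x" "x \<in> carrier G" "y \<in> carrier G"
  shows "x [^] (i::int) \<otimes> y = y \<otimes> x [^] i"
proof (cases i)
  case (nonneg n)
  then show ?thesis using group_commutes_pow[OF assms] by (simp add: int_pow_int)
next
  case (neg n)
  have "x [^] Suc n \<otimes> y = y \<otimes> x [^] Suc n" by (rule group_commutes_pow[OF assms])
  then have "inv (x [^] Suc n) \<otimes> y = y \<otimes> inv (x [^] Suc n)"
    using assms by (metis inv_solve_left inv_solve_right m_assoc inv_closed m_closed nat_pow_closed)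
  then show ?thesis using neg assms by (simp only: int_pow_neg_int)
qed

text \<open>The basis consists of a nontrivial central \<open>z\<close> in \<open>H\<close> and any
  \<open>w\<close> in \<open>H\<close> outside the powers of \<open>z\<close>. Conjugation fixes
  \<open>z\<close>, which makes its matrix triangular; the second diagonal entry is 1 because
  \<open>G\<close> has odd order.\<close>

lemma exists_unipotent_plane:
  fixes G (structure)
  assumes G: "group G" and ord: "order G = 3 ^ n" and H: "H \<lhd> G"
    and iso: "G\<lparr>carrier := H\<rparr> \<cong> integer_mod_group 3 \<times>\<times> integer_mod_group 3"
  shows "\<exists>E c. unipotent_plane H G E c"
proof -
  interpret normal H G by fact
  have K: "group (G\<lparr>carrier := H\<rparr>)" by (rule subgroup_is_group[OF G])
  have card: "card H = 9" using C3_times_C3_properties(1)[OF K iso] by simp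
  then have finH: "finite H" using card.infinite by fastforce
  interpret K: comm_group "G\<lparr>carrier := H\<rparr>" by (rule C3_times_C3_properties(2)[OF K iso])
  have Hc: "x \<in> carrier G" if "x \<in> H" for x using that subset by blast
  have comm: "x \<otimes> y = y \<otimes> x" if "x \<in> H" "y \<in> H" for x y
    using K.m_comm that by simp
  have cube: "x [^] (3::nat) = \<one>" if "x \<in> H" for x
    using C3_times_C3_properties(3)[OF K iso] that Hc
    by (simp add: numeral_3_eq_3)
  have ord3: "ord x = 3" if "x \<in> H" "x \<noteq> \<one>" for x
  proof -
    have "ord x dvd 3" using cube that Hc pow_eq_id by blast
    moreover have "ord x \<noteq> 1" using that Hc ord_eq_1 by blast
    moreover have "Factorial_Ring.prime (3::nat)" by simp
    ultimately show ?thesis by (metis prime_nat_iff)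
  qed
  have pow_H: "x [^] (i::int) \<in> H" if "x \<in> H" for x i
    using that subgroup_int_pow_closed[OF is_subgroup] by blast
  obtain z where z: "z \<in> H" "z \<noteq> \<one>" and cen: "\<And>g. g \<in> carrier G \<Longrightarrow> g \<otimes> z = z \<otimes> g"
    using p_group_normal_meets_centre[OF _ ord H] card by auto
  have "H \<noteq> (\<lambda>i. z [^] i) ` {0..<3::int}"
  proof
    assume "H = (\<lambda>i. z [^] i) ` {0..<3::int}"
    then show False using card card_image_le[of "{0..<3::int}" "\<lambda>i. z [^] i"] by simp
  qed
  then obtain w where w: "w \<in> H" "w \<notin> (\<lambda>i. z [^] i) ` {0..<3::int}"
    using pow_H[OF z(1)] by blast
  have zpow: "z [^] i = z [^] k \<longleftrightarrow> 3 dvd i - k" for i k :: int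
    using int_pow_eq[of z i k] ord3[OF z] z Hc by (simp add: dvd_diff_commute)
  have "z [^] i = z [^] (i mod 3)" for i :: int by (simp add: zpow)
  then have w_notin: "w \<noteq> z [^] i" for i :: int using w(2) by (metis atLeastLessThan_iff image_eqI
    pos_mod_bound pos_mod_sign zero_less_numeral)
  have "w \<noteq> \<one>" using w_notin[of 0] by simp
  then have wpow: "w [^] i = w [^] k \<longleftrightarrow> 3 dvd i - k" for i k :: int
    using int_pow_eq[of w i k] ord3[of w] w Hc by (simp add: dvd_diff_commute)
  \<comment> \<open>If 3 does not divide \<open>j\<close>, then \<open>j\<close> is its own inverse
    modulo 3, and raising to the power \<open>j\<close> would express \<open>w\<close> as a power of
    \<open>z\<close>.\<close>
  have indep: "3 dvd j" if "w [^] j = z [^] i" for i j :: int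
  proof (rule ccontr)
    assume "\<not> 3 dvd j"
    then have "j mod 3 = 1 \<or> j mod 3 = 2" by presburger
    then have "(j * j) mod 3 = 1" by (auto simp: mod_mult_eq[symmetric, of j])
    then have "3 dvd j * j - 1" by presburger
    then have "w [^] (j * j) = w [^] (1::int)" by (simp add: wpow)
    moreover have "w [^] (j * j) = z [^] (i * j)"
      using that w z Hc by (metis int_pow_pow)
    ultimately show False using w_notin[of "i * j"] w Hc by simp
  qed
  define E where "E i j = z [^] i \<otimes> w [^] j" for i j :: int
  note [simp] = Hc[OF z(1)] Hc[OF w(1)]
  have E_in: "E i j \<in> H" for i j
    using z w pow_H by (simp add: E_def)
  have E_closed [simp]: "E i j \<in> carrier G" for i j using E_in Hc by blast
  have zc: "z [^] i \<otimes> g = g \<otimes> z [^] i" if "g \<in> carrier G" for g and i :: int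
    using that cen by (intro int_pow_commute) auto
  have E_mult: "E i j \<otimes> E k l = E (i + k) (j + l)" for i j k l
  proof -
    have "E i j \<otimes> E k l = z [^] i \<otimes> (w [^] j \<otimes> z [^] k) \<otimes> w [^] l"
      by (simp add: E_def m_assoc)
    also have "\<dots> = (z [^] i \<otimes> z [^] k) \<otimes> (w [^] j \<otimes> w [^] l)"
      by (simp add: zc[of "w [^] j", symmetric] m_assoc)
    finally show ?thesis by (simp add: E_def int_pow_mult)
  qed
  have E_eq: "E i j = E k l \<longleftrightarrow> 3 dvd i - k \<and> 3 dvd j - l" for i j k l
  proof
    assume eq: "E i j = E k l"
    \<comment> \<open>Multiplying on both sides isolates a power of \<open>z\<close> and a power of
      \<open>w\<close>, so that \<open>indep\<close> applies.\<close>
    then have "E (-k) 0 \<otimes> E i j \<otimes> E 0 (-j) = E (-k) 0 \<otimes> E k l \<otimes> E 0 (-j)" by simp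
    then have "z [^] (i - k) = w [^] (l - j)" by (simp add: E_mult) (simp add: E_def)
    then have "3 dvd l - j" using indep by metis
    then have j: "3 dvd j - l" by (simp add: dvd_diff_commute)
    then have "w [^] j = w [^] l" by (simp add: wpow)
    then have "z [^] i = z [^] k" using eq by (simp add: E_def)
    then show "3 dvd i - k \<and> 3 dvd j - l" using j zpow by simp
  next
    assume "3 dvd i - k \<and> 3 dvd j - l"
    then have "z [^] i = z [^] k" "w [^] j = w [^] l" by (simp_all only: zpow wpow)
    then show "E i j = E k l" by (simp add: E_def)
  qed
  have E_surj: "\<exists>i j. h = E i j" if "h \<in> H" for h
  proof -
    let ?S = "{0..<3::int} \<times> {0..<3::int}"
    \<comment> \<open>Nine distinct products exhaust \<open>H\<close>, which has nine
      elements.\<close>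
    have "inj_on (\<lambda>(i, j). E i j) ?S"
    proof (rule inj_onI, clarify)
      fix i j k l :: int
      assume b: "i \<in> {0..<3}" "j \<in> {0..<3}" "k \<in> {0..<3}" "l \<in> {0..<3}" and "E i j = E k l"
      then have "3 dvd i - k" "3 dvd j - l" by (simp_all add: E_eq)
      then show "i = k \<and> j = l" using b by simp presburger
    qed
    then have "card ((\<lambda>(i, j). E i j) ` ?S) = card H" using card by (simp add: card_image)
    moreover have "(\<lambda>(i, j). E i j) ` ?S \<subseteq> H" using E_in by auto
    ultimately have "(\<lambda>(i, j). E i j) ` ?S = H" using card_subset_eq[OF finH] by blast
    then show ?thesis using that by auto
  qed
  have E_pow: "E i j [^] (m::int) = E (i * m) (j * m)" for i j m
    using int_pow_mult_distrib[OF zc[of "w [^] j" i], of m] by (simp add: E_def int_pow_pow)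
  \<comment> \<open>Conjugation by \<open>x\<close> is an endomorphism fixing the central
    \<open>z\<close>, so the image of \<open>w\<close> determines it on all of
    \<open>H\<close>.\<close>
  have swap: "E i j \<otimes> x = x \<otimes> E (i + k * j) (l * j)"
    if x: "x \<in> carrier G" and k: "inv x \<otimes> w \<otimes> x = E k l" for x i j k l
  proof -
    have cancel: "x \<otimes> (inv x \<otimes> y) = y" if "y \<in> carrier G" for y
      using x that by (simp add: m_assoc[symmetric])
    interpret conj: group_hom G G "\<lambda>y. inv x \<otimes> y \<otimes> x"
      using x by unfold_locales (auto simp: hom_def m_assoc cancel)
    have "inv x \<otimes> w [^] j \<otimes> x = E k l [^] j"
      using conj.hom_int_pow[of w j] k by simp
    then have "x \<otimes> (inv x \<otimes> w [^] j \<otimes> x) = x \<otimes> E (k * j) (l * j)" by (simp add: E_pow)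
    then have "w [^] j \<otimes> x = x \<otimes> E (k * j) (l * j)"
      using x by (simp add: m_assoc[symmetric])
    then have "E i j \<otimes> x = z [^] i \<otimes> (x \<otimes> E (k * j) (l * j))"
      using x by (simp add: E_def m_assoc)
    also have "\<dots> = x \<otimes> (E i 0 \<otimes> E (k * j) (l * j))"
      using x by (simp add: E_def m_assoc[symmetric] zc[OF x])
    finally show ?thesis by (simp add: E_mult)
  qed
  have "\<exists>k. \<forall>i j. E i j \<otimes> x = x \<otimes> E (i + k * j) j" if x: "x \<in> carrier G" for x
  proof -
    obtain k l where kl: "inv x \<otimes> w \<otimes> x = E k l"
      using inv_op_closed1[OF x w(1)] E_surj by blast
    note sw = swap[OF x kl]
    \<comment> \<open>Since \<open>x\<close> has odd order, \<open>l\<close> is a unit of odd order modulo 3, hence \<open>l = 1\<close> modulo 3.\<close>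
    have "\<exists>a. E 0 1 \<otimes> x [^] m = x [^] m \<otimes> E a (l ^ m)" for m :: nat
    proof (induction m)
      case (Suc m)
      then obtain a where a: "E 0 1 \<otimes> x [^] m = x [^] m \<otimes> E a (l ^ m)" by blast
      have "E 0 1 \<otimes> x [^] Suc m = x [^] m \<otimes> (E a (l ^ m) \<otimes> x)"
        using x a by (simp add: m_assoc[symmetric])
      also have "\<dots> = x [^] Suc m \<otimes> E (a + k * l ^ m) (l ^ Suc m)"
        using x by (simp add: sw m_assoc)
      finally show ?case by blast
    qed (auto intro: exI[of _ 0])
    then obtain a where "E 0 1 \<otimes> x [^] order G = x [^] order G \<otimes> E a (l ^ order G)" by blast
    \<comment> \<open>The power of \<open>x\<close> cancels as it is the identity; the second
      coordinates then say that \<open>l ^ order G\<close> is 1 modulo 3.\<close>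
    then have "E 0 1 = E a (l ^ order G)" using pow_order_eq_1[OF x] by simp
    then have "3 dvd l ^ order G - 1" by (simp add: E_eq dvd_diff_commute)
    then have "3 dvd l - 1" using odd_power_cong_mod_3 ord by simp
    then have "3 dvd (l - 1) * j" for j by simp
    then have "E (i + k * j) (l * j) = E (i + k * j) j" for i j
      by (simp add: E_eq left_diff_distrib)
    then show ?thesis using sw by metis
  qed
  then obtain c where c: "\<And>x i j. x \<in> carrier G \<Longrightarrow> E i j \<otimes> x = x \<otimes> E (i + c x * j) j"
    by metis
  have "unipotent_plane H G E c"
    by (intro unipotent_plane.intro unipotent_plane_axioms.intro normal_axioms)
      (rule E_in E_mult E_eq | erule E_surj c)+
  then show ?thesis by blast
qed

theorem theorem3p3:
  fixes G :: "('a, 'm) monoid_scheme" and H :: "'a set"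
  assumes "group G"
    and "finite (carrier G)"
    and "\<exists>n::nat. order G = 3 ^ n"
    and "H \<lhd> G"
    and "G\<lparr>carrier := H\<rparr> \<cong> integer_mod_group 3 \<times>\<times> integer_mod_group 3"
    and "colourable (G Mod H)"
  shows "colourable G"
proof -
  obtain E c where "unipotent_plane H G E c"
    using exists_unipotent_plane assms(1,3,4,5) by blast
  then show ?thesis
    using unipotent_plane.colourable_if_quotient_colourable assms(2,6) by blast
qed

end
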